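(* Let $j\geq m\geq 2$ and $n\geq 2$ be integers, and let $G$ be a graph with maximum degree $\Delta=\Delta(G)$. Then \[ m_j(K_m,G)\geq \Big\lfloor \frac{\Delta-1}{\lceil \frac{j}{m-1}\rceil-1}\Big\rfloor+1 . \]
   Context: All graphs are simple; $K_m$ is the complete graph on $m$ vertices. For integers $j\geq 2$ and $t\geq 1$, $K_{j\times t}$ denotes the complete multipartite graph with $j$ parts, each of size $t$. For graphs $H$ and $G$, the size multipartite Ramsey number $m_j(H,G)$ is the smallest natural number $t$ such that every coloring of the edges of $K_{j\times t}$ with two colors red and blue contains a red copy of $H$ or a blue copy of $G$ as a subgraph. *)

theory Defs
  imports Complex_Main "HOL-Library.Ramsey" "HOL-Library.Extended_Nat"
begin

text \<open>A graph is a pair of a vertex set and a set of edges; edges are 2-element sets of vertices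
  (\<open>[V]\<^bsup>2\<^esup>\<close> is the set of 2-element subsets of \<open>V\<close>).\<close>

type_synonym 'a ugraph = "'a set \<times> 'a set set"

abbreviation verts :: "'a ugraph \<Rightarrow> 'a set" where
  "verts G \<equiv> fst G"

abbreviation edges :: "'a ugraph \<Rightarrow> 'a set set" where
  "edges G \<equiv> snd G"

definition simple_graph :: "'a ugraph \<Rightarrow> bool" where
  "simple_graph G \<longleftrightarrow> finite (verts G) \<and> edges G \<subseteq> [verts G]\<^bsup>2\<^esup>"

definition degree :: "'a ugraph \<Rightarrow> 'a \<Rightarrow> nat" where
  "degree G v = card {e \<in> edges G. v \<in> e}"

text \<open>Inserting 0 only matters for the graph without vertices, whose maximum degree is thereby 0.\<close>

definition max_degree :: "'a ugraph \<Rightarrow> nat" where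
  "max_degree G = Max (insert 0 (degree G ` verts G))"

definition complete_graph :: "nat \<Rightarrow> nat ugraph" where
  "complete_graph m = ({..<m}, [{..<m}]\<^bsup>2\<^esup>)"

text \<open>The vertex \<open>(i, k)\<close> is the \<open>k\<close>-th vertex of the \<open>i\<close>-th part.\<close>

definition complete_multipartite :: "nat \<Rightarrow> nat \<Rightarrow> (nat \<times> nat) ugraph" where
  "complete_multipartite j t =
    ({..<j} \<times> {..<t},
     {{u, v} | u v. u \<in> {..<j} \<times> {..<t} \<and> v \<in> {..<j} \<times> {..<t} \<and> fst u \<noteq> fst v})"

text \<open>\<open>G\<close> contains a (not necessarily induced) copy of \<open>H\<close> as a subgraph.\<close>

definition contains_copy :: "'a ugraph \<Rightarrow> 'b ugraph \<Rightarrow> bool" where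
  "contains_copy G H \<longleftrightarrow>
    (\<exists>f. inj_on f (verts H) \<and> f ` verts H \<subseteq> verts G \<and> (\<forall>e\<in>edges H. f ` e \<in> edges G))"

datatype colour = Red | Blue

definition colour_class :: "'a ugraph \<Rightarrow> ('a set \<Rightarrow> colour) \<Rightarrow> colour \<Rightarrow> 'a ugraph" where
  "colour_class G c x = (verts G, {e \<in> edges G. c e = x})"

text \<open>The infimum is taken in the extended naturals, so that the number is \<open>\<infinity>\<close> if no \<open>t\<close> has the
  required property (as happens, e.g., for \<open>j = 5\<close> and \<open>H = G = K\<^sub>3\<close>); otherwise it is the least
  such \<open>t\<close>.\<close>

definition multipartite_ramsey :: "nat \<Rightarrow> 'a ugraph \<Rightarrow> 'b ugraph \<Rightarrow> enat" where
  "multipartite_ramsey j H G =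
    Inf {enat t | t. t \<ge> 1 \<and>
      (\<forall>c. contains_copy (colour_class (complete_multipartite j t) c Red) H \<or>
           contains_copy (colour_class (complete_multipartite j t) c Blue) G)}"

end

theory Submission
  imports Defs
begin

text \<open>Put \<open>q = \<lceil>j / (m - 1)\<rceil>\<close> and split the \<open>j\<close> parts into at most \<open>m - 1\<close> consecutive blocks
  of at most \<open>q\<close> parts. Colour an edge blue if it stays inside a block and red otherwise. The red
  graph is \<open>(m - 1)\<close>-partite, so it has no \<open>K\<^sub>m\<close>, while every blue degree is at most \<open>(q - 1) t\<close>.
  Hence a blue copy of \<open>G\<close> forces \<open>\<Delta> \<le> (q - 1) t\<close>.\<close>

text \<open>Part \<open>i\<close> lies in block \<open>i div q\<close>. Quantifying over the common
  block \<open>s\<close> avoids naming the ends of an unordered edge.\<close>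

definition block_colouring :: "nat \<Rightarrow> (nat \<times> nat) set \<Rightarrow> colour" where
  "block_colouring q e = (if \<exists>s. \<forall>u\<in>e. fst u div q = s then Blue else Red)"

text \<open>Taking images under \<open>f\<close> sends the edges at \<open>v\<close> to edges at
  \<open>f v\<close>. It is injective on them because they are subsets of \<open>verts H\<close>,
  where \<open>f\<close> is injective. Finiteness of the target matters since \<open>card\<close> of
  an infinite set is 0.\<close>

lemma degree_le_if_copy:
  assumes "simple_graph H" and "v \<in> verts H"
    and inj: "inj_on f (verts H)"
    and edge: "\<forall>e\<in>edges H. f ` e \<in> edges G"
    and fin: "finite {e \<in> edges G. f v \<in> e}"
  shows "degree H v \<le> degree G (f v)"
  unfolding degree_def
proof (rule card_inj_on_le[OF _ _ fin])
  have "{e \<in> edges H. v \<in> e} \<subseteq> Pow (verts H)"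
    using assms(1) by (auto simp: simple_graph_def nsets_def)
  then show "inj_on ((`) f) {e \<in> edges H. v \<in> e}"
    using inj by (meson inj_on_image_Pow inj_on_subset)
  show "(`) f ` {e \<in> edges H. v \<in> e} \<subseteq> {e \<in> edges G. f v \<in> e}"
    using edge by auto
qed

lemma max_degree_le:
  assumes "simple_graph G" and "\<And>v. v \<in> verts G \<Longrightarrow> degree G v \<le> b"
  shows "max_degree G \<le> b"
  using assms by (auto simp: max_degree_def simple_graph_def)

lemma block_colouring_no_red_clique:
  assumes "j \<le> q * d" and "d < m"
  shows "\<not> contains_copy (colour_class (complete_multipartite j t) (block_colouring q) Red)
    (complete_graph m)"
proof
  assume "contains_copy (colour_class (complete_multipartite j t) (block_colouring q) Red)
    (complete_graph m)"
  then obtain f where f: "f ` {..<m} \<subseteq> {..<j} \<times> {..<t}"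
    and red: "\<forall>e\<in>[{..<m}]\<^bsup>2\<^esup>. block_colouring q (f ` e) = Red"
    by (auto simp: contains_copy_def colour_class_def complete_graph_def complete_multipartite_def)
  let ?g = "\<lambda>x. fst (f x) div q"
  have "?g x < d" if "x < m" for x
  proof -
    have "fst (f x) < j" using f that by fastforce
    then show ?thesis using assms(1) by (simp add: less_mult_imp_div_less mult.commute)
  qed
  then have "?g ` {..<m} \<subseteq> {..<d}" by auto
  then have "card (?g ` {..<m}) < card {..<m}"
    using card_mono[of "{..<d}" "?g ` {..<m}"] assms(2) by simp
  \<comment> \<open>Two of the \<open>m\<close> clique vertices share one of the \<open>d\<close>
    blocks. If they even share a part, \<open>block_colouring\<close> still gives their pair the
    value \<open>Blue\<close>, so this case needs no separate argument.\<close>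
  then have "\<not> inj_on ?g {..<m}" by (rule pigeonhole)
  then obtain x y where xy: "x < m" "y < m" "x \<noteq> y" "?g x = ?g y"
    by (auto simp: inj_on_def)
  then have "{x, y} \<in> [{..<m}]\<^bsup>2\<^esup>" by (auto simp: nsets_def)
  with red have "block_colouring q (f ` {x, y}) = Red" by blast
  with xy show False by (auto simp: block_colouring_def split: if_splits)
qed

lemma block_colouring_blue_degree:
  fixes j t q :: nat
  assumes "0 < q"
  defines "B \<equiv> colour_class (complete_multipartite j t) (block_colouring q) Blue"
  shows "finite {e \<in> edges B. u \<in> e}" and "degree B u \<le> (q - 1) * t"
proof -
  define s where "s = fst u div q"
  let ?P = "{s * q..<s * q + q}"
  let ?N = "(?P - {fst u}) \<times> {..<t}"
  have block: "x \<in> ?P" if "x div q = s" for x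
  proof -
    have "x = s * q + x mod q" using div_mult_mod_eq[of x q] that by simp
    moreover have "x mod q < q" using assms(1) by simp
    ultimately show ?thesis unfolding atLeastLessThan_iff by linarith
  qed
  \<comment> \<open>A blue edge at \<open>u\<close> is determined by its other end, which lies in
    the block of \<open>u\<close> but in another part. The last block may extend beyond part
    \<open>j - 1\<close>, so \<open>?N\<close> can overcount; an upper bound suffices.\<close>
  have sub: "{e \<in> edges B. u \<in> e} \<subseteq> (\<lambda>w. {u, w}) ` ?N"
  proof
    fix e assume "e \<in> {e \<in> edges B. u \<in> e}"
    then have "block_colouring q e = Blue" "u \<in> e"
      and "\<exists>v w. e = {v, w} \<and> v \<in> {..<j} \<times> {..<t} \<and> w \<in> {..<j} \<times> {..<t} \<and> fst v \<noteq> fst w"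
      by (auto simp: B_def colour_class_def complete_multipartite_def)
    moreover from this obtain w where e: "e = {u, w}" "w \<in> {..<j} \<times> {..<t}" "fst w \<noteq> fst u"
      by (elim exE conjE) (metis insert_commute insertE singletonD)
    ultimately have "fst w div q = s"
      by (auto simp: block_colouring_def s_def split: if_splits)
    then have "w \<in> ?N" using e block[of "fst w"] by (auto simp: mem_Times_iff)
    then show "e \<in> (\<lambda>w. {u, w}) ` ?N" using e(1) by blast
  qed
  then show "finite {e \<in> edges B. u \<in> e}"
    by (rule finite_subset) simp
  have "degree B u \<le> card ?N"
    unfolding degree_def by (rule surj_card_le[OF _ sub]) simp
  \<comment> \<open>The part of \<open>u\<close> belongs to its own block, so removing it leaves
    exactly \<open>q - 1\<close> parts.\<close>
  also have "\<dots> = (q - 1) * t"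
    using block[of "fst u"] by (simp add: s_def card_cartesian_product)
  finally show "degree B u \<le> (q - 1) * t" .
qed

lemma max_degree_le_if_ramsey:
  assumes "simple_graph G" and "0 < q" and "j \<le> q * d" and "d < m"
    and "\<forall>c. contains_copy (colour_class (complete_multipartite j t) c Red) (complete_graph m) \<or>
           contains_copy (colour_class (complete_multipartite j t) c Blue) G"
  shows "max_degree G \<le> (q - 1) * t"
proof -
  let ?B = "colour_class (complete_multipartite j t) (block_colouring q) Blue"
  have "contains_copy ?B G"
    using assms(5) block_colouring_no_red_clique[OF assms(3,4)] by blast
  then obtain f where f: "inj_on f (verts G)" "\<forall>e\<in>edges G. f ` e \<in> edges ?B"
    unfolding contains_copy_def by blast
  show ?thesis
  proof (rule max_degree_le[OF assms(1)])
    fix v assume "v \<in> verts G"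
    then have "degree G v \<le> degree ?B (f v)"
      using degree_le_if_copy[OF assms(1) _ f] block_colouring_blue_degree(1)[OF assms(2)] by blast
    also have "\<dots> \<le> (q - 1) * t"
      by (rule block_colouring_blue_degree(2)[OF assms(2)])
    finally show "degree G v \<le> (q - 1) * t" .
  qed
qed

theorem theorem3:
  fixes j m n :: nat and G :: "'a ugraph"
  assumes "j \<ge> m" and "m \<ge> 2" and "n \<ge> 2"
    and "simple_graph G"
  shows "multipartite_ramsey j (complete_graph m) G \<ge>
    enat (nat (\<lfloor>(real (max_degree G) - 1) / real_of_int (\<lceil>real j / (real m - 1)\<rceil> - 1)\<rfloor> + 1))"
  unfolding multipartite_ramsey_def
\<comment> \<open>Bounding every admissible \<open>t\<close> from below also covers the case of no
  admissible \<open>t\<close>, where the infimum is infinite.\<close>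
proof (rule Inf_greatest, clarify)
  fix t
  assume ramsey: "\<forall>c. contains_copy (colour_class (complete_multipartite j t) c Red) (complete_graph m) \<or>
           contains_copy (colour_class (complete_multipartite j t) c Blue) G"
  define q where "q = nat \<lceil>real j / (real m - 1)\<rceil>"
  \<comment> \<open>From \<open>j \<ge> m > m - 1\<close> the ceiling is at least 2, so the
    denominator \<open>q - 1\<close> of the claimed bound is positive.\<close>
  have "1 < real j / (real m - 1)" using assms(1,2) by simp
  then have "1 < \<lceil>real j / (real m - 1)\<rceil>" by linarith
  then have q: "1 < q" and ceil: "\<lceil>real j / (real m - 1)\<rceil> = int q"
    by (auto simp: q_def)
  have "real j / (real m - 1) \<le> real q" using ceil by linarith
  then have "real j \<le> real q * (real m - 1)"
    using assms(2) by (simp add: pos_divide_le_eq)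
  also have "\<dots> = real (q * (m - 1))" using assms(2) by (simp add: of_nat_diff)
  finally have "j \<le> q * (m - 1)" by linarith
  then have "max_degree G \<le> (q - 1) * t"
    using max_degree_le_if_ramsey[OF assms(4) _ _ _ ramsey, of q "m - 1"] q assms(2) by simp
  then have "real (max_degree G) \<le> real ((q - 1) * t)" by (rule of_nat_mono)
  \<comment> \<open>Subtracting 1 makes the inequality strict. It stays strict under division and
    \<open>floor\<close>, and for integers \<open>floor < t\<close> means
    \<open>floor + 1 \<le> t\<close>.\<close>
  then have "real (max_degree G) - 1 < real t * (real q - 1)"
    using q by (simp add: of_nat_diff mult.commute)
  then have "(real (max_degree G) - 1) / (real q - 1) < real t"
    using q by (simp add: pos_divide_less_eq)
  then have "\<lfloor>(real (max_degree G) - 1) / (real q - 1)\<rfloor> < int t"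
    by (simp add: floor_less_iff)
  then show "enat (nat (\<lfloor>(real (max_degree G) - 1) / real_of_int (\<lceil>real j / (real m - 1)\<rceil> - 1)\<rfloor> + 1))
      \<le> enat t"
    by (simp add: ceil)
qed

end
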